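(* Let $q\ge 5$ be a prime power and let $\ell$ be a line of $\mathrm{PG}(3,q)$ containing no point of the twisted cubic $\mathcal{C}$. For each plane type $\pi\in\{\Gamma,2_{\mathcal C},3_{\mathcal C},\overline{1_{\mathcal C}},0_{\mathcal C}\}$ let $\Pi_\pi(\ell)$ denote the number of $\pi$-planes containing $\ell$. Then $$\Pi_{\Gamma}(\ell)+\Pi_{\overline{1_{\mathcal C}}}(\ell)+2\Pi_{2_{\mathcal C}}(\ell)+3\Pi_{3_{\mathcal C}}(\ell)=q+1,\qquad \Pi_{0_{\mathcal C}}(\ell)=\Pi_{2_{\mathcal C}}(\ell)+2\Pi_{3_{\mathcal C}}(\ell).$$
   Context: Let $q$ be a prime power and $\mathrm{PG}(3,q)$ the projective space over $\mathbb{F}_q$ with points $\mathbf{P}(x_0,x_1,x_2,x_3)$. Put $P(t)=\mathbf{P}(t^3,t^2,t,1)$ for $t\in\mathbb{F}_q$ and $P(\infty)=\mathbf{P}(1,0,0,0)$; the twisted cubic is $\mathcal{C}=\{P(t):t\in\mathbb{F}_q\cup\{\infty\}\}$. Denote by $\boldsymbol{\pi}(c_0,c_1,c_2,c_3)$ the plane $c_0x_0+c_1x_1+c_2x_2+c_3x_3=0$. The osculating plane at $P(t)$ is $\boldsymbol{\pi}(1,-3t,3t^2,-t^3)$ for $t\in\mathbb{F}_q$ and $\boldsymbol{\pi}(0,0,0,1)$ for $t=\infty$; these $q+1$ planes are the $\Gamma$-planes. Plane types: $\Gamma$-planes; for $d\in\{0,2,3\}$ a $d_{\mathcal C}$-plane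 is a plane containing exactly $d$ points of $\mathcal C$; a $\overline{1_{\mathcal C}}$-plane is a plane which is not a $\Gamma$-plane and contains exactly one point of $\mathcal C$. *)

theory Defs
  imports "HOL-Analysis.Cartesian_Space"
begin

text \<open>
  The field with \<open>q\<close> elements is a type \<open>'a :: {field, finite}\<close> with \<open>q = CARD('a)\<close>. A subspace of
  \<open>PG(3,q)\<close> is represented by the corresponding linear subspace of \<open>'a ^ 4\<close>, so incidence is set
  inclusion. The coordinates \<open>x\<^sub>0, x\<^sub>1, x\<^sub>2, x\<^sub>3\<close> are \<open>x $ 1, x $ 2, x $ 3, x $ 4\<close>.
\<close>

definition proj_lines :: "('a::field ^ 4) set set" where
  "proj_lines = {l. vec.subspace l \<and> vec.dim l = 2}"

definition proj_planes :: "('a::field ^ 4) set set" where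
  "proj_planes = {\<pi>. vec.subspace \<pi> \<and> vec.dim \<pi> = 3}"

text \<open>These two denote a point, respectively a plane, only if the four arguments are not all zero.\<close>

definition pt :: "'a::field \<Rightarrow> 'a \<Rightarrow> 'a \<Rightarrow> 'a \<Rightarrow> ('a ^ 4) set" where
  "pt x0 x1 x2 x3 = vec.span {vector [x0, x1, x2, x3]}"

definition plane :: "'a::field \<Rightarrow> 'a \<Rightarrow> 'a \<Rightarrow> 'a \<Rightarrow> ('a ^ 4) set" where
  "plane c0 c1 c2 c3 = {x. c0 * x $ 1 + c1 * x $ 2 + c2 * x $ 3 + c3 * x $ 4 = 0}"

text \<open>The parameter ranges over the field extended by \<open>\<infinity>\<close>, which is encoded as \<^const>\<open>None\<close>.\<close>

fun cubic_point :: "'a::field option \<Rightarrow> ('a ^ 4) set" where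
  "cubic_point (Some t) = pt (t ^ 3) (t ^ 2) t 1"
| "cubic_point None = pt 1 0 0 0"

definition twisted_cubic :: "('a::field ^ 4) set set" where
  "twisted_cubic = range cubic_point"

fun osculating_plane :: "'a::field option \<Rightarrow> ('a ^ 4) set" where
  "osculating_plane (Some t) = plane 1 (- 3 * t) (3 * t ^ 2) (- (t ^ 3))"
| "osculating_plane None = plane 0 0 0 1"

definition Gamma_planes :: "('a::field ^ 4) set set" where
  "Gamma_planes = range osculating_plane"

definition cubic_points_in :: "('a::field ^ 4) set \<Rightarrow> ('a ^ 4) set set" where
  "cubic_points_in S = {p \<in> twisted_cubic. p \<subseteq> S}"

text \<open>The \<open>d\<close>-planes of the twisted cubic are considered for \<open>d = 0, 2, 3\<close> only.\<close>

definition d_planes :: "nat \<Rightarrow> ('a::{field, finite} ^ 4) set set" where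
  "d_planes d = {\<pi> \<in> proj_planes. card (cubic_points_in \<pi>) = d}"

definition one_bar_planes :: "('a::{field, finite} ^ 4) set set" where
  "one_bar_planes = {\<pi> \<in> proj_planes. \<pi> \<notin> Gamma_planes \<and> card (cubic_points_in \<pi>) = 1}"

datatype plane_type = Gamma_type | Two_type | Three_type | One_bar_type | Zero_type

fun planes_of_type :: "plane_type \<Rightarrow> ('a::{field, finite} ^ 4) set set" where
  "planes_of_type Gamma_type = Gamma_planes"
| "planes_of_type Two_type = d_planes 2"
| "planes_of_type Three_type = d_planes 3"
| "planes_of_type One_bar_type = one_bar_planes"
| "planes_of_type Zero_type = d_planes 0"

definition num_planes :: "plane_type \<Rightarrow> ('a::{field, finite} ^ 4) set \<Rightarrow> nat" where
  "num_planes T l = card {\<pi> \<in> planes_of_type T. l \<subseteq> \<pi>}"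

end

theory Submission
  imports Defs "HOL-Computational_Algebra.Polynomial"
begin

text \<open>
  Every plane through \<open>\<ell>\<close> is spanned by \<open>\<ell>\<close> and any of its points off \<open>\<ell>\<close>. Hence the planes through
  \<open>\<ell>\<close> partition the points off \<open>\<ell>\<close>, which shows that there are \<open>q + 1\<close> of them, and they also
  partition the \<open>q + 1\<close> points of the cubic. A plane contains at most three points of the cubic, and
  a \<open>\<Gamma>\<close>-plane contains exactly one. Counting the points of the cubic plane by plane gives the first
  identity, and comparing it with the number of planes gives the second.
\<close>

section \<open>Cardinalities of subspaces over a finite field\<close>

lemma card_span_independent:
  fixes B :: "('a::{field, finite} ^ 'n) set"
  assumes "vec.independent B"
  shows "card (vec.span B) = CARD('a) ^ card B"
proof -
  have "finite B" by simp
  then show ?thesis using assms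
  proof (induction B)
    case empty
    then show ?case by simp
  next
    case (insert a B)
    have a: "a \<notin> vec.span B" and B: "vec.independent B"
      using insert.prems insert.hyps by (auto simp: vec.independent_insert)
    \<comment> \<open>As \<open>a\<close> lies outside the span of \<open>B\<close>, the coefficient
      \<open>k\<close> of a vector in the larger span is unique. So \<open>?f\<close> is a bijection
      and each basis vector multiplies the count by the field size.\<close>
    let ?f = "\<lambda>(k, x). k *s a + x"
    have "inj_on ?f (UNIV \<times> vec.span B)"
    proof (rule inj_onI, clarify)
      fix k x k' x'
      assume x: "x \<in> vec.span B" "x' \<in> vec.span B" and e: "k *s a + x = k' *s a + x'"
      have "(k - k') *s a = x' - x" using e by (simp add: vec.scale_left_diff_distrib algebra_simps)
      then have s: "(k - k') *s a \<in> vec.span B" using x by (simp add: vec.span_diff)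
      have "k = k'"
      proof (rule ccontr)
        assume "k \<noteq> k'"
        then have "inverse (k - k') *s ((k - k') *s a) = a" by simp
        then show False using a vec.span_scale[OF s, of "inverse (k - k')"] by argo
      qed
      then show "k = k' \<and> x = x'" using e by simp
    qed
    moreover have "?f ` (UNIV \<times> vec.span B) = vec.span (insert a B)"
    proof (intro equalityI subsetI)
      fix y assume "y \<in> vec.span (insert a B)"
      then obtain k where "y - k *s a \<in> vec.span B" by (auto simp: vec.span_breakdown_eq)
      then have "?f (k, y - k *s a) \<in> ?f ` (UNIV \<times> vec.span B)" by blast
      then show "y \<in> ?f ` (UNIV \<times> vec.span B)" by simp
    next
      fix y assume "y \<in> ?f ` (UNIV \<times> vec.span B)"
      then obtain k x where "y = k *s a + x" "x \<in> vec.span B" by auto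
      then have "y - k *s a \<in> vec.span B" by simp
      then show "y \<in> vec.span (insert a B)" unfolding vec.span_breakdown_eq by blast
    qed
    ultimately have "card (vec.span (insert a B)) = card ((UNIV :: 'a set) \<times> vec.span B)"
      by (metis card_image)
    then show ?case using insert.IH[OF B] insert.hyps by (simp add: card_cartesian_product)
  qed
qed

lemma card_subspace:
  fixes S :: "('a::{field, finite} ^ 'n) set"
  assumes "vec.subspace S"
  shows "card S = CARD('a) ^ vec.dim S"
proof -
  obtain B where "B \<subseteq> S" "vec.independent B" "S \<subseteq> vec.span B" "card B = vec.dim S"
    using vec.basis_exists by blast
  then show ?thesis
    using assms card_span_independent[of B] vec.span_subspace[of B S] by simp
qed

section \<open>Subspaces one dimension above a given one\<close>

definition cover :: "('a::field ^ 'n) set \<Rightarrow> ('a ^ 'n) set set" where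
  "cover W = {S. vec.subspace S \<and> vec.dim S = Suc (vec.dim W) \<and> W \<subseteq> S}"

text \<open>The span of \<open>x\<close> and \<open>W\<close> has dimension one more than
  \<open>W\<close>; a member of \<open>cover W\<close> through \<open>x\<close> contains this span
  and has equal dimension. Hence distinct members meet only in \<open>W\<close>.\<close>

lemma cover_containing_iff:
  fixes W :: "('a::field ^ 'n) set"
  assumes W: "vec.subspace W" and x: "x \<notin> W"
  shows "S \<in> cover W \<and> x \<in> S \<longleftrightarrow> S = vec.span (insert x W)"
proof -
  have d: "vec.dim (vec.span (insert x W)) = Suc (vec.dim W)"
    using x by (simp add: vec.dim_insert vec.span_eq_iff[THEN iffD2, OF W])
  show ?thesis
  proof
    assume S: "S \<in> cover W \<and> x \<in> S"
    then have "vec.span (insert x W) \<subseteq> S" by (intro vec.span_minimal) (auto simp: cover_def)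
    then show "S = vec.span (insert x W)"
      using S d vec.subspace_dim_equal[of "vec.span (insert x W)" S] by (simp add: cover_def)
  next
    assume "S = vec.span (insert x W)"
    then show "S \<in> cover W \<and> x \<in> S"
      using d vec.span_superset[of "insert x W"] by (auto simp: cover_def)
  qed
qed

text \<open>The sets \<open>S - W\<close> partition the complement of \<open>W\<close> into blocks
  of equal size. The product form avoids a division of naturals.\<close>

lemma card_cover:
  fixes W :: "('a::{field, finite} ^ 'n) set"
  assumes W: "vec.subspace W"
  shows "card (cover W) * (CARD('a) ^ Suc (vec.dim W) - CARD('a) ^ vec.dim W)
           = CARD('a) ^ CARD('n) - CARD('a) ^ vec.dim W"
proof -
  have U: "(\<Union>S\<in>cover W. S - W) = UNIV - W"
    using cover_containing_iff[OF W] by blast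
  have "card (S - W) = CARD('a) ^ Suc (vec.dim W) - CARD('a) ^ vec.dim W" if "S \<in> cover W" for S
    using that card_subspace[of S] card_subspace[OF W] by (simp add: cover_def card_Diff_subset)
  moreover have "card (\<Union>S\<in>cover W. S - W) = (\<Sum>S\<in>cover W. card (S - W))"
  proof (rule card_UN_disjoint)
    show "\<forall>S\<in>cover W. \<forall>T\<in>cover W. S \<noteq> T \<longrightarrow> (S - W) \<inter> (T - W) = {}"
    proof (intro ballI impI equals0I)
      fix S T x
      assume "S \<in> cover W" "T \<in> cover W" "S \<noteq> T" "x \<in> (S - W) \<inter> (T - W)"
      then show False
        using cover_containing_iff[OF W, of x S] cover_containing_iff[OF W, of x T] by simp
    qed
  qed simp_all
  ultimately have "card (cover W) * (CARD('a) ^ Suc (vec.dim W) - CARD('a) ^ vec.dim W)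
      = card (UNIV - W)"
    using U by simp
  also have "\<dots> = CARD('a) ^ CARD('n) - CARD('a) ^ vec.dim W"
    using card_subspace[OF W] by (simp add: card_Diff_subset)
  finally show ?thesis .
qed

section \<open>Planes and their linear equations\<close>

lemma vector_4 [simp]:
  "(vector [x, y, z, w] :: ('a::zero) ^ 4) $ 1 = x"
  "(vector [x, y, z, w] :: 'a ^ 4) $ 2 = y"
  "(vector [x, y, z, w] :: 'a ^ 4) $ 3 = z"
  "(vector [x, y, z, w] :: 'a ^ 4) $ 4 = w"
  unfolding vector_def by simp_all

lemma subspace_plane: "vec.subspace (plane a b c d)"
proof (rule vec.subspaceI)
  fix k x assume "x \<in> plane a b c d"
  then have "k * (a * x $ 1 + b * x $ 2 + c * x $ 3 + d * x $ 4) = 0" by (simp add: plane_def)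
  then show "k *s x \<in> plane a b c d" by (simp add: plane_def algebra_simps)
next
  fix x y assume "x \<in> plane a b c d" "y \<in> plane a b c d"
  then have "(a * x $ 1 + b * x $ 2 + c * x $ 3 + d * x $ 4)
      + (a * y $ 1 + b * y $ 2 + c * y $ 3 + d * y $ 4) = 0" by (simp add: plane_def)
  then show "x + y \<in> plane a b c d" by (simp add: plane_def algebra_simps)
qed (simp add: plane_def)

text \<open>The linear form \<open>f\<close> is nonzero at some unit vector \<open>e\<close>. Every
  vector is a multiple of \<open>e\<close> plus a zero of \<open>f\<close>, so adjoining
  \<open>e\<close> to the plane gives dimension 4.\<close>

lemma plane_in_proj_planes:
  assumes "(a, b, c, d) \<noteq> (0, 0, 0, 0)"
  shows "plane a b c d \<in> proj_planes"
proof -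
  define f where "f x = a * x $ 1 + b * x $ 2 + c * x $ 3 + d * x $ 4" for x :: "'a ^ 4"
  have f: "x \<in> plane a b c d \<longleftrightarrow> f x = 0" for x by (simp add: plane_def f_def)
  obtain e where e: "f e \<noteq> 0"
  proof -
    have "f (vector [1, 0, 0, 0]) = a" "f (vector [0, 1, 0, 0]) = b"
         "f (vector [0, 0, 1, 0]) = c" "f (vector [0, 0, 0, 1]) = d" by (simp_all add: f_def)
    then show thesis using that assms by metis
  qed
  have "f (y - k *s e) = f y - k * f e" for y k by (simp add: f_def algebra_simps)
  then have "y - (f y / f e) *s e \<in> plane a b c d" for y using e by (simp add: f)
  then have "y \<in> vec.span (insert e (plane a b c d))" for y
    unfolding vec.span_breakdown_eq using vec.span_base by blast
  then have "vec.span (insert e (plane a b c d)) = UNIV" by blast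
  then have "vec.dim (insert e (plane a b c d)) = CARD(4)"
    by (metis vec.dim_span vec_dim_card)
  moreover have "e \<notin> vec.span (plane a b c d)"
    using e by (simp add: f vec.span_eq_iff[THEN iffD2, OF subspace_plane])
  ultimately show ?thesis
    using subspace_plane[of a b c d] by (simp add: proj_planes_def vec.dim_insert)
qed

text \<open>A linear map that kills a basis of \<open>\<pi>\<close> and fixes a vector off
  \<open>\<pi>\<close> supplies the equation. The inclusion suffices to bound the cubic points in
  \<open>\<pi>\<close> from above.\<close>

lemma proj_plane_subset_plane:
  assumes "\<pi> \<in> proj_planes"
  obtains a b c d where "(a, b, c, d) \<noteq> (0, 0, 0, 0)" "\<pi> \<subseteq> plane a b c d"
proof -
  have S: "vec.subspace \<pi>" and d: "vec.dim \<pi> = 3" using assms by (auto simp: proj_planes_def)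
  have "\<pi> \<noteq> UNIV" using d vec_dim_card[where 'a='a and 'n=4] by auto
  then obtain x where x: "x \<notin> \<pi>" by blast
  obtain B where B: "B \<subseteq> \<pi>" "vec.independent B" "\<pi> \<subseteq> vec.span B"
    using vec.basis_exists[of \<pi>] by metis
  then have sB: "vec.span B = \<pi>" using S vec.span_subspace by blast
  have "vec.independent (insert x B)"
    using vec.independent_insertI[of x B] x sB B(2) by blast
  then obtain f where f: "Vector_Spaces.linear (*s) (*s) f"
    and fv: "\<forall>y\<in>insert x B. f y = (if y = x then x else 0)"
    using vec.linear_independent_extend[of "insert x B" "\<lambda>y. if y = x then x else 0"] by blast
  have "f y = 0" if "y \<in> \<pi>" for y
  proof (rule vec.linear_eq_0_on_span[OF f])
    show "y \<in> vec.span B" using that sB by simp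
    show "f z = 0" if "z \<in> B" for z using fv that x B(1) by auto
  qed
  then have f0: "matrix f *v y = 0" if "y \<in> \<pi>" for y
    using that by (simp add: matrix_works[OF f])
  have "x \<noteq> 0" using x vec.subspace_0[OF S] by auto
  then have "matrix f *v x \<noteq> 0" using fv by (simp add: matrix_works[OF f])
  \<comment> \<open>The map is vector-valued; a coordinate in which the image of \<open>x\<close> is
    nonzero selects a scalar form, and row \<open>i\<close> of the matrix holds its
    coefficients.\<close>
  then obtain i where i: "(matrix f *v x) $ i \<noteq> 0" by (auto simp: vec_eq_iff)
  let ?A = "matrix f"
  have row: "(?A *v y) $ i
      = ?A $ i $ 1 * y $ 1 + ?A $ i $ 2 * y $ 2 + ?A $ i $ 3 * y $ 3 + ?A $ i $ 4 * y $ 4" for y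
    by (simp add: matrix_vector_mult_def sum_4)
  show thesis
  proof (rule that)
    show "(?A $ i $ 1, ?A $ i $ 2, ?A $ i $ 3, ?A $ i $ 4) \<noteq> (0, 0, 0, 0)"
      using i by (auto simp: row)
    show "\<pi> \<subseteq> plane (?A $ i $ 1) (?A $ i $ 2) (?A $ i $ 3) (?A $ i $ 4)"
      using f0 by (auto simp: plane_def row[symmetric])
  qed
qed

section \<open>Incidence of cubic points with planes\<close>

fun cubic_vec :: "'a::field option \<Rightarrow> 'a ^ 4" where
  "cubic_vec (Some t) = vector [t ^ 3, t ^ 2, t, 1]"
| "cubic_vec None = vector [1, 0, 0, 0]"

lemma cubic_point_subset_iff:
  assumes "vec.subspace S"
  shows "cubic_point s \<subseteq> S \<longleftrightarrow> cubic_vec s \<in> S"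
proof -
  have "cubic_point s = vec.span {cubic_vec s}" by (cases s) (simp_all add: pt_def)
  then show ?thesis
    using assms vec.span_minimal[of "{cubic_vec s}" S] vec.span_base[of "cubic_vec s"] by auto
qed

lemma subspace_osculating_plane: "vec.subspace (osculating_plane t)"
  by (cases t) (simp_all add: subspace_plane)

text \<open>Substituting the point with parameter \<open>x\<close> into the osculating plane at
  \<open>y\<close> gives \<open>(x - y) ^ 3\<close>, which vanishes only for \<open>x = y\<close>.
  If exactly one parameter is \<open>None\<close>, the value is 1; if both are, it is 0.\<close>

lemma cubic_point_subset_osculating_plane_iff:
  "cubic_point s \<subseteq> osculating_plane t \<longleftrightarrow> s = t"
proof -
  have "x ^ 3 + (- 3 * y) * x ^ 2 + 3 * y ^ 2 * x + - (y ^ 3) = (x - y) ^ 3" for x y :: 'a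
    by (simp add: power3_eq_cube power2_eq_square algebra_simps)
  then have "x ^ 3 + (- 3 * y) * x ^ 2 + 3 * y ^ 2 * x + - (y ^ 3) = 0 \<longleftrightarrow> x = y" for x y :: 'a
    by simp
  then show ?thesis
    unfolding cubic_point_subset_iff[OF subspace_osculating_plane]
    by (cases s; cases t) (simp_all add: plane_def)
qed

text \<open>Each osculating plane recovers the parameter of the only cubic point in it.\<close>

lemma inj_cubic_point: "inj cubic_point"
  by (rule injI) (metis cubic_point_subset_osculating_plane_iff)

lemma card_twisted_cubic:
  "card (twisted_cubic :: ('a::{field, finite} ^ 4) set set) = CARD('a) + 1"
  unfolding twisted_cubic_def by (simp add: card_image[OF inj_cubic_point] card_UNIV_option)

lemma Gamma_plane_in_proj_planes: "\<pi> \<in> Gamma_planes \<Longrightarrow> \<pi> \<in> proj_planes"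
proof -
  have "osculating_plane t \<in> proj_planes" for t :: "'a option"
    by (cases t) (auto intro!: plane_in_proj_planes)
  then show "\<pi> \<in> Gamma_planes \<Longrightarrow> \<pi> \<in> proj_planes" by (auto simp: Gamma_planes_def)
qed

lemma card_cubic_points_in_Gamma_plane:
  assumes "\<pi> \<in> Gamma_planes"
  shows "card (cubic_points_in \<pi>) = 1"
proof -
  obtain t where "\<pi> = osculating_plane t" using assms by (auto simp: Gamma_planes_def)
  then have "cubic_point s \<subseteq> \<pi> \<longleftrightarrow> s = t" for s
    by (simp add: cubic_point_subset_osculating_plane_iff)
  then have "cubic_points_in \<pi> = {cubic_point t}"
    unfolding cubic_points_in_def twisted_cubic_def by auto
  then show ?thesis by simp
qed

text \<open>The finite parameters of cubic points in a plane are roots of a nonzero polynomial of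
  degree at most 3, and the point at infinity can occur only if \<open>a = 0\<close>.\<close>

lemma card_cubic_points_in_plane_le:
  fixes \<pi> :: "('a::{field, finite} ^ 4) set"
  assumes "\<pi> \<in> proj_planes"
  shows "card (cubic_points_in \<pi>) \<le> 3"
proof -
  obtain a b c d where nz: "(a, b, c, d) \<noteq> (0, 0, 0, 0)" and sub: "\<pi> \<subseteq> plane a b c d"
    using assms by (rule proj_plane_subset_plane)
  define p where "p = [:d, c, b, a:]"
  define R where "R = {t. poly p t = 0}"
  define N where "N = (if a = 0 then {None} else {} :: 'a option set)"
  have "card R \<le> degree p"
    unfolding R_def using nz by (intro card_poly_roots_bound) (auto simp: p_def)
  \<comment> \<open>When \<open>a = 0\<close>, the degree drops to at most 2, which leaves room for
    the point at infinity.\<close>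
  moreover have "degree p + card N \<le> 3" by (auto simp: p_def N_def degree_pCons_eq_if)
  moreover have "card (Some ` R \<union> N) \<le> card R + card N"
    by (metis card_Un_le card_image inj_Some)
  ultimately have R: "card (Some ` R \<union> N) \<le> 3" by linarith
  have "s \<in> Some ` R \<union> N" if "cubic_point s \<subseteq> \<pi>" for s
  proof -
    have "cubic_vec s \<in> plane a b c d"
      using that sub cubic_point_subset_iff[OF subspace_plane] by blast
    then show ?thesis
      by (cases s) (auto simp: plane_def N_def R_def p_def power3_eq_cube power2_eq_square
          algebra_simps)
  qed
  then have "cubic_points_in \<pi> \<subseteq> cubic_point ` (Some ` R \<union> N)"
    by (auto simp: cubic_points_in_def twisted_cubic_def)
  then have "card (cubic_points_in \<pi>) \<le> card (cubic_point ` (Some ` R \<union> N))"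
    by (intro card_mono) simp_all
  also have "\<dots> \<le> card (Some ` R \<union> N)" by (rule card_image_le) simp
  finally show ?thesis using R by linarith
qed

section \<open>Double counting in the pencil of planes through the line\<close>

theorem theorem4p4:
  fixes l :: "('a::{field, finite} ^ 4) set" and q :: nat
  assumes "q = CARD('a)"
    and "q \<ge> 5"
    and "l \<in> proj_lines"
    and "\<not> (\<exists>p \<in> twisted_cubic. p \<subseteq> l)"
  shows "num_planes Gamma_type l + num_planes One_bar_type l
           + 2 * num_planes Two_type l + 3 * num_planes Three_type l = q + 1
       \<and> num_planes Zero_type l = num_planes Two_type l + 2 * num_planes Three_type l"
proof -
  have l: "vec.subspace l" "vec.dim l = 2" using assms(3) by (auto simp: proj_lines_def)
  define P where "P = cover l"
  have P: "\<pi> \<in> P \<longleftrightarrow> \<pi> \<in> proj_planes \<and> l \<subseteq> \<pi>" for \<pi>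
    by (auto simp: P_def cover_def proj_planes_def l)
  \<comment> \<open>Here \<open>l\<close> has vector dimension 2 in a space of dimension 4. The
    common factor can be cancelled because \<open>q \<ge> 5\<close> makes it positive.\<close>
  have "card P * (q ^ 3 - q ^ 2) = q ^ 4 - q ^ 2"
    using card_cover[OF l(1)] by (simp add: l(2) P_def assms(1) numeral_3_eq_3 del: power_Suc)
  also have "\<dots> = (q + 1) * (q ^ 3 - q ^ 2)"
    by (simp add: diff_mult_distrib2 algebra_simps eval_nat_numeral)
  finally have "card P * (q ^ 3 - q ^ 2) = (q + 1) * (q ^ 3 - q ^ 2)" .
  moreover have "q ^ 3 - q ^ 2 \<noteq> 0"
    using assms(2) power_strict_increasing[of 2 3 q] by simp
  ultimately have "card P = q + 1" by (metis mult_right_cancel)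
  \<comment> \<open>Since \<open>l\<close> misses the cubic, each cubic point together with
    \<open>l\<close> spans exactly one plane of the pencil.\<close>
  have ex1: "\<exists>!\<pi>. \<pi> \<in> P \<and> p \<subseteq> \<pi>" if p: "p \<in> twisted_cubic" for p
  proof -
    obtain s where s: "p = cubic_point s" using p by (auto simp: twisted_cubic_def)
    then have "cubic_vec s \<notin> l" using assms(4) p cubic_point_subset_iff[OF l(1)] by blast
    then have "\<pi> \<in> P \<and> p \<subseteq> \<pi> \<longleftrightarrow> \<pi> = vec.span (insert (cubic_vec s) l)" for \<pi>
      using cover_containing_iff[OF l(1), of "cubic_vec s" \<pi>] cubic_point_subset_iff[of \<pi> s]
      unfolding s P_def cover_def by blast
    then show ?thesis by auto
  qed
  have "(\<Union>\<pi>\<in>P. cubic_points_in \<pi>) = twisted_cubic"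
    using ex1 by (fastforce simp: cubic_points_in_def)
  moreover have "card (\<Union>\<pi>\<in>P. cubic_points_in \<pi>) = (\<Sum>\<pi>\<in>P. card (cubic_points_in \<pi>))"
    by (rule card_UN_disjoint) (use ex1 in \<open>auto simp: cubic_points_in_def\<close>)
  ultimately have points: "(\<Sum>\<pi>\<in>P. card (cubic_points_in \<pi>)) = q + 1"
    using card_twisted_cubic[where 'a='a] assms(1) by simp
  \<comment> \<open>Grouping the pencil by the number \<open>k\<close> of cubic points, at most 3,
    turns the plane count into the sum of \<open>n k\<close> and the point count into the sum of
    \<open>k * n k\<close>. Both equal \<open>q + 1\<close>.\<close>
  define n where "n k = card {\<pi> \<in> P. card (cubic_points_in \<pi>) = k}" for k
  have range: "(\<lambda>\<pi>. card (cubic_points_in \<pi>)) ` P \<subseteq> {..3}"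
    using card_cubic_points_in_plane_le P by auto
  have "(\<Sum>\<pi>\<in>P. 1) = (\<Sum>k\<le>3. \<Sum>\<pi> | \<pi> \<in> P \<and> card (cubic_points_in \<pi>) = k. 1 :: nat)"
    by (rule sum.group[OF _ _ range, symmetric]) simp_all
  then have planes_eq: "n 0 + n 1 + n 2 + n 3 = q + 1"
    using \<open>card P = q + 1\<close> by (simp add: n_def numeral_3_eq_3 numeral_2_eq_2)
  have "(\<Sum>\<pi>\<in>P. card (cubic_points_in \<pi>))
      = (\<Sum>k\<le>3. \<Sum>\<pi> | \<pi> \<in> P \<and> card (cubic_points_in \<pi>) = k. card (cubic_points_in \<pi>))"
    by (rule sum.group[OF _ _ range, symmetric]) simp_all
  also have "\<dots> = (\<Sum>k\<le>3. k * n k)"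
    by (intro sum.cong) (simp_all add: n_def)
  finally have points_eq: "n 1 + 2 * n 2 + 3 * n 3 = q + 1"
    using points by (simp add: numeral_3_eq_3 numeral_2_eq_2)
  have d: "card {\<pi> \<in> d_planes k. l \<subseteq> \<pi>} = n k" for k
    unfolding n_def by (rule arg_cong[of _ _ card]) (auto simp: d_planes_def P)
  \<comment> \<open>The planes with one cubic point are the \<open>\<Gamma>\<close>-planes and,
    disjoint from them by definition, the planes in \<open>one_bar_planes\<close>.\<close>
  have "{\<pi> \<in> P. card (cubic_points_in \<pi>) = 1}
      = {\<pi> \<in> Gamma_planes. l \<subseteq> \<pi>} \<union> {\<pi> \<in> one_bar_planes. l \<subseteq> \<pi>}"
    using Gamma_plane_in_proj_planes card_cubic_points_in_Gamma_plane
    by (auto simp: P one_bar_planes_def)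
  then have "n 1 = num_planes Gamma_type l + num_planes One_bar_type l"
    unfolding n_def num_planes_def
    by (simp, subst card_Un_disjoint) (auto simp: one_bar_planes_def)
  moreover have "num_planes Zero_type l = n 0" "num_planes Two_type l = n 2"
    "num_planes Three_type l = n 3"
    by (simp_all add: num_planes_def d)
  \<comment> \<open>The point count is the first identity; subtracting the plane count from it
    leaves \<open>n 0 = n 2 + 2 * n 3\<close>.\<close>
  ultimately show ?thesis using planes_eq points_eq by linarith
qed

end
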